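(* Let $\Gamma=(V,E)$ be a finite, undirected, unweighted, connected graph with $N\ge2$ vertices (loops allowed), with Cheeger constant $h$, dual Cheeger constant $\overline{h}$, and balance constant $\mathcal{R}$. Then $$\frac{N-1}{N}\,h\le\frac{2\mathcal{R}}{1+\mathcal{R}}\,h\le\overline{h}\le1,$$ and equality holds in the first (leftmost) inequality if and only if $\Gamma$ is a regular graph and $N$ is odd.
   Context: Unweighted means $w_{ij}=1$ if $i\sim j$ (i.e. $i,j$ are joined by an edge; $i=j$ allowed, a loop) and $w_{ij}=0$ otherwise. The degree is $d_i=\sum_jw_{ij}$; regular means all $d_i$ are equal. $\mathrm{vol}(U)=\sum_{i\in U}d_i$, $|E(U,W)|=\sum_{k\in U,l\in W}w_{kl}$, $\overline{U}=V\setminus U$. The Cheeger constant is $h=\min_U\frac{|E(U,\overline{U})|}{\min\{\mathrm{vol}(U),\mathrm{vol}(\overline{U})\}}$ over $U$ with $U,\overline{U}$ nonempty. The dual Cheeger constant is $\overline{h}=\max_{V_1,V_2}\frac{2|E(V_1,V_2)|}{\mathrm{vol}(V_1)+\mathrm{vol}(V_2)}$ over disjoint nonempty $V_1,V_2\subseteq V$ (whose union need not be $V$). Finally $\mathcal{R}=\max_U\mathcal{R}(U)$ over partitions $U,\overline{U}$ of $V$, where $\mathcal{R}(U)=\frac{\min(\mathrm{vol}(U),\mathrm{vol}(\overline{U}))}{\max(\mathrm{vol}(U),\mathrm{vol}(\overline{U}))}$. *)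

theory Defs
  imports Complex_Main "Graph_Theory.Digraph_Component"
begin

text \<open>
  A finite undirected graph with loops allowed is a \<^locale>\<open>pair_pseudo_graph\<close>: finitely many
  vertices and a symmetric set of ordered pairs. An edge between distinct vertices is thus
  represented by two arcs, and a loop by one, so that a loop contributes 1 to the degree.
\<close>

definition weight :: "'a pair_pre_digraph \<Rightarrow> 'a \<Rightarrow> 'a \<Rightarrow> real" where
  "weight G i j = (if (i, j) \<in> parcs G then 1 else 0)"

definition degree :: "'a pair_pre_digraph \<Rightarrow> 'a \<Rightarrow> real" where
  "degree G i = (\<Sum>j\<in>pverts G. weight G i j)"

definition regular_graph :: "'a pair_pre_digraph \<Rightarrow> bool" where
  "regular_graph G \<longleftrightarrow> (\<forall>i\<in>pverts G. \<forall>j\<in>pverts G. degree G i = degree G j)"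

definition vol :: "'a pair_pre_digraph \<Rightarrow> 'a set \<Rightarrow> real" where
  "vol G U = (\<Sum>i\<in>U. degree G i)"

definition edge_count :: "'a pair_pre_digraph \<Rightarrow> 'a set \<Rightarrow> 'a set \<Rightarrow> real" where
  "edge_count G U W = (\<Sum>k\<in>U. \<Sum>l\<in>W. weight G k l)"

definition bipartitions :: "'a pair_pre_digraph \<Rightarrow> ('a set \<times> 'a set) set" where
  "bipartitions G = {(U, pverts G - U) | U. U \<subseteq> pverts G \<and> U \<noteq> {} \<and> pverts G - U \<noteq> {}}"

text \<open>
  The extrema below range over sets that are finite, and nonempty as soon as the graph has at
  least two vertices. If the graph is moreover connected, then every degree is positive, so no
  denominator vanishes.
\<close>

definition cheeger :: "'a pair_pre_digraph \<Rightarrow> real" where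
  "cheeger G = Min {edge_count G U W / min (vol G U) (vol G W) | U W. (U, W) \<in> bipartitions G}"

definition dual_cheeger :: "'a pair_pre_digraph \<Rightarrow> real" where
  "dual_cheeger G = Max {2 * edge_count G V1 V2 / (vol G V1 + vol G V2) | V1 V2.
     V1 \<subseteq> pverts G \<and> V2 \<subseteq> pverts G \<and> V1 \<noteq> {} \<and> V2 \<noteq> {} \<and> V1 \<inter> V2 = {}}"

definition balance :: "'a pair_pre_digraph \<Rightarrow> real" where
  "balance G = Max {min (vol G U) (vol G W) / max (vol G U) (vol G W) | U W.
     (U, W) \<in> bipartitions G}"

end

theory Submission
  imports Defs
begin

text \<open>
  If \<open>D\<close> is the smallest imbalance \<open>|vol U - vol (V - U)|\<close>, then \<open>2 R / (1 + R) = 1 - D / vol V\<close>,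
  so the first inequality says that \<open>D\<close> is at most the average degree. To see this, collect a set
  \<open>T\<close> by repeatedly adding a vertex of degree below \<open>D + vol T\<close>: the bound
  \<open>|vol U - vol (V - T - U)| \<ge> D + vol T\<close> for all \<open>U \<subseteq> V - T\<close> is preserved, because the new
  vertex could be put on the lighter side. At the end all other vertices have degree at least
  \<open>D + vol T\<close>, and since degrees lie between 1 and \<open>N\<close>, comparing sums gives \<open>N D \<le> vol V\<close>, with
  equality only if \<open>T\<close> is empty and all degrees equal \<open>D\<close>.
\<close>

section \<open>Imbalance of splittings of a finite set of weights\<close>

lemma exists_large_outside:
  fixes f :: "'a \<Rightarrow> real" and D :: real
  assumes fin: "finite X" and ne: "X \<noteq> {}" and pos: "\<And>i. i \<in> X \<Longrightarrow> 0 < f i" and D: "0 \<le> D"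
    and imb: "\<And>U. U \<subseteq> X \<Longrightarrow> D \<le> \<bar>sum f U - sum f (X - U)\<bar>"
  shows "\<exists>T\<subset>X. \<forall>i\<in>X - T. D + sum f T \<le> f i"
proof -
  \<comment> \<open>A maximal \<open>T\<close> with this invariant stands in for the end of the
    iteration: a vertex of degree below \<open>D + sum f T\<close> could still be added to
    it.\<close>
  define P where "P T \<longleftrightarrow> T \<subseteq> X \<and>
    (\<forall>U\<subseteq>X - T. D + sum f T \<le> \<bar>sum f U - sum f (X - T - U)\<bar>)" for T
  have "finite {T. P T}"
    by (rule finite_subset[OF _ finite_Pow_iff[THEN iffD2, OF fin]]) (auto simp: P_def)
  moreover have "P {}"
    using imb by (simp add: P_def)
  ultimately obtain T where T: "P T" and max: "\<And>S. P S \<Longrightarrow> T \<subseteq> S \<Longrightarrow> S = T"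
    using finite_has_maximal[of "{T. P T}"] by blast
  have TX: "T \<subseteq> X" and bnd: "\<And>U. U \<subseteq> X - T \<Longrightarrow> D + sum f T \<le> \<bar>sum f U - sum f (X - T - U)\<bar>"
    using T by (auto simp: P_def)
  have finT: "finite T"
    using TX fin by (rule finite_subset)
  have "T \<noteq> X"
  proof
    assume "T = X"
    then have "D + sum f X \<le> 0"
      using bnd[of "{}"] by simp
    moreover have "0 < sum f X"
      using fin ne pos by (rule sum_pos)
    ultimately show False
      using D by linarith
  qed
  moreover have "D + sum f T \<le> f i" if i: "i \<in> X - T" for i
  proof (rule ccontr)
    assume small: "\<not> D + sum f T \<le> f i"
    have "P (insert i T)"
      unfolding P_def
    proof (intro conjI allI impI)
      show "insert i T \<subseteq> X"
        using TX i by blast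
      fix U assume U: "U \<subseteq> X - insert i T"
      define W where "W = X - insert i T - U"
      have fins: "finite U" "finite W"
        using U fin by (auto simp: W_def intro: finite_subset)
      have iU: "i \<notin> U" "i \<notin> W"
        using U by (auto simp: W_def)
      \<comment> \<open>Since \<open>i\<close> may join \<open>U\<close> or \<open>W\<close>, the
        bound holds for \<open>\<bar>x + f i\<bar>\<close> and \<open>\<bar>x - f i\<bar>\<close>,
        where \<open>x = sum f U - sum f W\<close>. As \<open>f i\<close> is smaller than the bound,
        moving \<open>i\<close> to the lighter side cannot reverse the sign of the difference, so
        \<open>\<bar>x\<bar>\<close> exceeds the bound by at least \<open>f i\<close>.\<close>
      have "X - T - insert i U = W" "X - T - U = insert i W"
        using U i by (auto simp: W_def)
      then have "D + sum f T \<le> \<bar>f i + sum f U - sum f W\<bar>"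
        and "D + sum f T \<le> \<bar>sum f U - (f i + sum f W)\<bar>"
        using bnd[of "insert i U"] bnd[of U] U i fins iU by auto
      moreover have "0 < f i"
        using pos i by blast
      ultimately have "D + (f i + sum f T) \<le> \<bar>sum f U - sum f W\<bar>"
        using small by linarith
      then show "D + sum f (insert i T) \<le> \<bar>sum f U - sum f (X - insert i T - U)\<bar>"
        using i finT by (simp add: W_def)
    qed
    then show False
      using max[of "insert i T"] i by blast
  qed
  ultimately show ?thesis
    using TX by blast
qed

text \<open>With \<open>s = sum f T\<close> and \<open>b\<close> elements outside \<open>T\<close>,
  the total is at least \<open>b * (D + s) + s\<close>. The part \<open>b * s\<close> makes up for
  the missing \<open>card T * D\<close>, because \<open>card T \<le> s\<close> and
  \<open>D \<le> b\<close>. The spare \<open>s\<close> vanishes only for empty \<open>T\<close>,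
  which settles equality.\<close>

lemma card_times_imbalance_le:
  fixes f :: "'a \<Rightarrow> real" and D :: real
  assumes fin: "finite X" and ne: "X \<noteq> {}" and D: "0 \<le> D"
    and ge: "\<And>i. i \<in> X \<Longrightarrow> 1 \<le> f i" and le: "\<And>i. i \<in> X \<Longrightarrow> f i \<le> card X"
    and imb: "\<And>U. U \<subseteq> X \<Longrightarrow> D \<le> \<bar>sum f U - sum f (X - U)\<bar>"
  shows "card X * D \<le> sum f X"
    and "card X * D = sum f X \<Longrightarrow> i \<in> X \<Longrightarrow> f i = D"
proof -
  have "0 < f i" if "i \<in> X" for i
    using ge[OF that] by linarith
  from exists_large_outside[OF fin ne this D imb]
  obtain T where T: "T \<subset> X" and large: "\<And>i. i \<in> X - T \<Longrightarrow> D + sum f T \<le> f i"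
    by blast
  have finT: "finite T"
    using T fin by (meson finite_subset psubset_imp_subset)
  define s where "s = sum f T"
  define b where "b = real (card (X - T))"
  have t: "real (card T) \<le> s"
    using sum_mono[of T "\<lambda>_. 1" f] ge T by (auto simp: s_def)
  have card: "real (card X) = card T + b"
    using T fin finT card_mono[of X T] by (auto simp: b_def card_Diff_subset of_nat_diff)
  \<comment> \<open>One element outside \<open>T\<close> suffices for \<open>D \<le> b\<close>: its
    value is at least \<open>D + s\<close> and at most \<open>card X = card T + b\<close>, while
    \<open>card T \<le> s\<close>.\<close>
  obtain j where "j \<in> X - T"
    using T by blast
  then have "D + s \<le> card X"
    using large[of j] le[of j] by (auto simp: s_def)
  then have Db: "D \<le> b"
    using t card by linarith
  have "b * (D + s) = (\<Sum>i\<in>X - T. D + s)"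
    by (simp add: b_def)
  also have "\<dots> \<le> sum f (X - T)"
    using large by (intro sum_mono) (auto simp: s_def)
  finally have rest: "b * (D + s) \<le> sum f (X - T)" .
  have total: "sum f X = sum f (X - T) + s"
    using T fin by (simp add: s_def sum.subset_diff[of T X])
  have "card T * D \<le> s * b"
    using t Db D by (intro mult_mono) auto
  then have key: "card X * D + s \<le> sum f X"
    using rest total by (simp add: card algebra_simps)
  moreover have "0 \<le> s"
    using t by linarith
  ultimately show "card X * D \<le> sum f X"
    by linarith
  assume eq: "card X * D = sum f X" and i: "i \<in> X"
  have "s = 0"
    using key eq \<open>0 \<le> s\<close> by linarith
  then have "T = {}"
    using t finT by auto
  then have "\<And>k. k \<in> X \<Longrightarrow> D \<le> f k"
    using large by simp
  moreover have "(\<Sum>k\<in>X. f k - D) = 0"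
    using eq by (simp add: sum_subtractf)
  ultimately show "f i = D"
    using sum_nonneg_eq_0_iff[OF fin, of "\<lambda>k. f k - D"] i by auto
qed

section \<open>The factor \<open>2 * R / (1 + R)\<close>\<close>

text \<open>The first form cancels against the denominator of a Cheeger quotient. The second, by
  \<open>2 * min a b = a + b - \<bar>a - b\<bar>\<close>, turns balance into imbalance.\<close>

lemma balance_transform:
  fixes a b :: real
  assumes "0 < a" "0 < b" "R = min a b / max a b"
  shows "2 * R / (1 + R) = 2 * min a b / (a + b)"
    and "2 * R / (1 + R) = 1 - \<bar>a - b\<bar> / (a + b)"
proof -
  have "1 + R = (a + b) / max a b"
    using assms by (auto simp: min_def max_def field_simps)
  then show *: "2 * R / (1 + R) = 2 * min a b / (a + b)"
    using assms by (simp add: max_def)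
  show "2 * R / (1 + R) = 1 - \<bar>a - b\<bar> / (a + b)"
    unfolding * using assms(1,2) by (auto simp: min_def field_simps)
qed

lemma balance_transform_mono:
  fixes r R :: real
  assumes "0 \<le> r" "r \<le> R"
  shows "2 * r / (1 + r) \<le> 2 * R / (1 + R)"
  using assms by (simp add: field_simps)

section \<open>Degrees, volumes and edge counts in a connected graph\<close>

locale connected_pseudo_graph = pair_pseudo_graph G for G :: "'a pair_pre_digraph" +
  assumes connected: "Digraph_Component.connected (with_proj G)"
    and card_ge_2: "2 \<le> card (pverts G)"
begin

lemma weight_commute: "weight G i j = weight G j i"
  using arcs_symmetric by (auto simp: weight_def)

lemma weight_nonneg: "0 \<le> weight G i j"
  by (simp add: weight_def)

lemma edge_count_commute: "edge_count G U W = edge_count G W U"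
  unfolding edge_count_def by (subst sum.swap) (simp add: weight_commute)

lemma vol_verts_split:
  assumes "U \<subseteq> pverts G"
  shows "vol G U + vol G (pverts G - U) = vol G (pverts G)"
  using assms pair_finite_verts by (simp add: vol_def sum.subset_diff[of U "pverts G"])

lemma edge_count_le_vol:
  assumes "W \<subseteq> pverts G"
  shows "edge_count G U W \<le> vol G U"
  unfolding edge_count_def vol_def degree_def
  using assms pair_finite_verts by (intro sum_mono sum_mono2) (auto simp: weight_nonneg)

lemma edge_count_pos:
  assumes "U \<subseteq> pverts G" "U \<noteq> {}" "pverts G - U \<noteq> {}"
  shows "0 < edge_count G U (pverts G - U)"
proof -
  obtain u v where uv: "u \<in> U" "v \<in> pverts G - U"
    using assms by blast
  \<comment> \<open>Connectedness refers to the symmetrized graph; symmetry of the arcs turns it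
    into a directed walk from \<open>u\<close> to \<open>v\<close>, and such a walk must leave
    \<open>U\<close> along some arc.\<close>
  have "strongly_connected (with_proj G)"
    using connected sym_arcs by (intro symmetric_connected_imp_strongly_connected)
  then have "u \<rightarrow>\<^sup>*\<^bsub>with_proj G\<^esub> v"
    using uv assms(1) by (auto simp: strongly_connected_def)
  then have "v \<in> U \<or> (\<exists>x\<in>U. \<exists>y\<in>pverts G - U. (x, y) \<in> parcs G)"
    using in_arcsD2 uv(1) by (induction rule: reachable_induct) auto
  then obtain x y where xy: "x \<in> U" "y \<in> pverts G - U" "(x, y) \<in> parcs G"
    using uv by blast
  have fin: "finite U" "finite (pverts G - U)"
    using assms(1) pair_finite_verts by (auto intro: finite_subset)
  have "0 < (\<Sum>l\<in>pverts G - U. weight G x l)"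
    using fin(2) xy(2,3) by (intro sum_pos2[of _ y]) (auto simp: weight_def)
  then show ?thesis
    unfolding edge_count_def
    by (intro sum_pos2[OF fin(1) xy(1)]) (auto simp: sum_nonneg weight_nonneg)
qed

lemma degree_eq_card: "degree G i = card {j \<in> pverts G. (i, j) \<in> parcs G}"
  using pair_finite_verts by (simp add: degree_def weight_def sum.If_cases Int_def)

text \<open>Some edge leaves \<open>{i}\<close>, so the degree is positive, and being a cardinality
  it is at least 1.\<close>

lemma degree_ge_1:
  assumes "i \<in> pverts G"
  shows "1 \<le> degree G i"
proof -
  have "pverts G - {i} \<noteq> {}"
    using card_ge_2 card_mono[of "{i}" "pverts G"] by auto
  then have "0 < edge_count G {i} (pverts G - {i})"
    using assms by (intro edge_count_pos) auto
  also have "\<dots> \<le> degree G i"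
    using edge_count_le_vol[of "pverts G - {i}" "{i}"] by (simp add: vol_def)
  finally show ?thesis
    by (simp add: degree_eq_card)
qed

lemma degree_le_card: "degree G i \<le> card (pverts G)"
  using pair_finite_verts by (auto simp: degree_eq_card intro!: card_mono)

lemma vol_pos:
  assumes "U \<subseteq> pverts G" "U \<noteq> {}"
  shows "0 < vol G U"
  unfolding vol_def
proof (rule sum_pos)
  show "finite U"
    using assms(1) pair_finite_verts by (rule finite_subset)
  show "0 < degree G i" if "i \<in> U" for i
    using degree_ge_1[of i] assms(1) that by auto
qed (rule assms(2))

section \<open>The extremal constants\<close>

lemma finite_bipartitions: "finite (bipartitions G)"
proof -
  have "bipartitions G \<subseteq> Pow (pverts G) \<times> Pow (pverts G)"
    by (auto simp: bipartitions_def)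
  then show ?thesis
    using pair_finite_verts by (meson finite_Pow_iff finite_SigmaI finite_subset)
qed

lemma bipartitions_nonempty: "bipartitions G \<noteq> {}"
proof -
  obtain i where "i \<in> pverts G"
    using card_ge_2 by fastforce
  moreover have "pverts G - {i} \<noteq> {}"
    using card_ge_2 card_mono[of "{i}" "pverts G"] by auto
  ultimately show ?thesis
    by (auto simp: bipartitions_def)
qed

lemma bipartitionsD:
  assumes "(U, W) \<in> bipartitions G"
  shows "W = pverts G - U" "U \<subseteq> pverts G" "W \<subseteq> pverts G" "U \<inter> W = {}"
    "0 < vol G U" "0 < vol G W" "vol G U + vol G W = vol G (pverts G)" "0 < edge_count G U W"
proof -
  have *: "W = pverts G - U" "U \<subseteq> pverts G" "U \<noteq> {}" "W \<noteq> {}"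
    using assms by (auto simp: bipartitions_def)
  then show "W = pverts G - U" "U \<subseteq> pverts G" "W \<subseteq> pverts G" "U \<inter> W = {}"
    by auto
  show "0 < vol G U" "0 < vol G W"
    using * by (auto intro!: vol_pos)
  show "vol G U + vol G W = vol G (pverts G)" "0 < edge_count G U W"
    using * vol_verts_split edge_count_pos by simp_all
qed

lemma bipartition_values:
  "{F U W | U W. (U, W) \<in> bipartitions G} = (\<lambda>(U, W). F U W) ` bipartitions G"
  by auto

lemma cheeger_le:
  assumes "(U, W) \<in> bipartitions G"
  shows "cheeger G \<le> edge_count G U W / min (vol G U) (vol G W)"
  unfolding cheeger_def bipartition_values
  using assms finite_bipartitions by (intro Min_le) auto

text \<open>Strictness allows the Cheeger constant to be cancelled in the equality case.\<close>

lemma cheeger_pos: "0 < cheeger G"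
  unfolding cheeger_def bipartition_values
  using finite_bipartitions bipartitions_nonempty
  by (subst Min_gr_iff) (auto intro!: divide_pos_pos simp: bipartitionsD(5,6,8))

lemma balance_ge:
  assumes "(U, W) \<in> bipartitions G"
  shows "min (vol G U) (vol G W) / max (vol G U) (vol G W) \<le> balance G"
  unfolding balance_def bipartition_values
  using assms finite_bipartitions by (intro Max_ge) auto

lemma balance_attained:
  obtains U W where "(U, W) \<in> bipartitions G"
    "balance G = min (vol G U) (vol G W) / max (vol G U) (vol G W)"
proof -
  have "balance G \<in> (\<lambda>(U, W). min (vol G U) (vol G W) / max (vol G U) (vol G W)) ` bipartitions G"
    unfolding balance_def bipartition_values
    using finite_bipartitions bipartitions_nonempty by (intro Max_in) auto
  then show ?thesis
    using that by auto
qed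

lemma finite_dual_values:
  "finite {2 * edge_count G V1 V2 / (vol G V1 + vol G V2) | V1 V2.
     V1 \<subseteq> pverts G \<and> V2 \<subseteq> pverts G \<and> V1 \<noteq> {} \<and> V2 \<noteq> {} \<and> V1 \<inter> V2 = {}}" (is "finite ?S")
proof -
  have "?S \<subseteq> (\<lambda>(A, B). 2 * edge_count G A B / (vol G A + vol G B)) ` (Pow (pverts G) \<times> Pow (pverts G))"
    by auto
  then show ?thesis
    using pair_finite_verts by (meson finite_Pow_iff finite_SigmaI finite_imageI finite_subset)
qed

lemma dual_cheeger_ge:
  assumes "(U, W) \<in> bipartitions G"
  shows "2 * edge_count G U W / vol G (pverts G) \<le> dual_cheeger G"
  unfolding dual_cheeger_def
proof (rule Max_ge[OF finite_dual_values])
  show "2 * edge_count G U W / vol G (pverts G) \<in> {2 * edge_count G V1 V2 / (vol G V1 + vol G V2) | V1 V2.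
     V1 \<subseteq> pverts G \<and> V2 \<subseteq> pverts G \<and> V1 \<noteq> {} \<and> V2 \<noteq> {} \<and> V1 \<inter> V2 = {}}"
    using bipartitionsD[OF assms] assms
    by (intro CollectI exI[of _ U] exI[of _ W]) (auto simp: bipartitions_def)
qed

text \<open>By symmetry the edges between the two sets are bounded by the volume of either
  one.\<close>

lemma dual_cheeger_le_1: "dual_cheeger G \<le> 1"
  unfolding dual_cheeger_def
proof (rule Max.boundedI[OF finite_dual_values])
  show "{2 * edge_count G V1 V2 / (vol G V1 + vol G V2) | V1 V2.
     V1 \<subseteq> pverts G \<and> V2 \<subseteq> pverts G \<and> V1 \<noteq> {} \<and> V2 \<noteq> {} \<and> V1 \<inter> V2 = {}} \<noteq> {}"
    using bipartitions_nonempty unfolding bipartitions_def by blast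
next
  fix x
  assume "x \<in> {2 * edge_count G V1 V2 / (vol G V1 + vol G V2) | V1 V2.
     V1 \<subseteq> pverts G \<and> V2 \<subseteq> pverts G \<and> V1 \<noteq> {} \<and> V2 \<noteq> {} \<and> V1 \<inter> V2 = {}}"
  then obtain A B where x: "x = 2 * edge_count G A B / (vol G A + vol G B)"
    and AB: "A \<subseteq> pverts G" "B \<subseteq> pverts G" "A \<noteq> {}" "B \<noteq> {}"
    by blast
  have "2 * edge_count G A B \<le> vol G A + vol G B"
    using edge_count_le_vol[OF AB(2), of A] edge_count_le_vol[OF AB(1), of B]
    by (simp add: edge_count_commute[of B A])
  then show "x \<le> 1"
    using vol_pos[OF AB(1,3)] vol_pos[OF AB(2,4)] by (simp add: x)
qed

text \<open>For a bipartition attaining the balance, the smaller volume cancels between the factor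
  and the Cheeger quotient, leaving a quotient admissible for the dual constant.\<close>

lemma balance_cheeger_le_dual_cheeger:
  "2 * balance G / (1 + balance G) * cheeger G \<le> dual_cheeger G"
proof -
  obtain U W where UW: "(U, W) \<in> bipartitions G"
    and R: "balance G = min (vol G U) (vol G W) / max (vol G U) (vol G W)"
    by (rule balance_attained)
  note bip = bipartitionsD[OF UW]
  have "2 * balance G / (1 + balance G) * cheeger G
      = 2 * min (vol G U) (vol G W) / vol G (pverts G) * cheeger G"
    using balance_transform(1)[OF bip(5,6) R] bip(7) by simp
  also have "\<dots> \<le> 2 * min (vol G U) (vol G W) / vol G (pverts G)
      * (edge_count G U W / min (vol G U) (vol G W))"
    using bip by (intro mult_left_mono cheeger_le[OF UW]) auto
  also have "\<dots> = 2 * edge_count G U W / vol G (pverts G)"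
    using bip by auto
  also have "\<dots> \<le> dual_cheeger G"
    by (rule dual_cheeger_ge[OF UW])
  finally show ?thesis .
qed

section \<open>Smallest imbalance and average degree\<close>

lemma minimal_imbalance:
  obtains D :: real where "0 \<le> D" "2 * balance G / (1 + balance G) = 1 - D / vol G (pverts G)"
    "\<forall>U\<subseteq>pverts G. D \<le> \<bar>vol G U - vol G (pverts G - U)\<bar>"
    "\<exists>U\<subseteq>pverts G. D = \<bar>vol G U - vol G (pverts G - U)\<bar>"
proof -
  obtain U0 W0 where UW0: "(U0, W0) \<in> bipartitions G"
    and R: "balance G = min (vol G U0) (vol G W0) / max (vol G U0) (vol G W0)"
    by (rule balance_attained)
  note bip0 = bipartitionsD[OF UW0]
  define D where "D = \<bar>vol G U0 - vol G W0\<bar>"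
  have tr: "2 * balance G / (1 + balance G) = 1 - D / vol G (pverts G)"
    using balance_transform(2)[OF bip0(5,6) R] bip0(7) by (simp add: D_def)
  have v: "0 < vol G (pverts G)"
    using bip0 by linarith
  have "D \<le> \<bar>vol G U - vol G (pverts G - U)\<bar>" if U: "U \<subseteq> pverts G" for U
  \<comment> \<open>The trivial subsets are not bipartitions, but their imbalance is the whole
    volume. For the others, a smaller ratio means a larger imbalance, as both sides sum to the same
    volume.\<close>
  proof (cases "U = {} \<or> U = pverts G")
    case True
    then show ?thesis
      using v bip0 by (auto simp: D_def vol_def)
  next
    case False
    define W where "W = pverts G - U"
    have UW: "(U, W) \<in> bipartitions G"
      using U False by (auto simp: bipartitions_def W_def)
    note bip = bipartitionsD[OF UW]
    define r where "r = min (vol G U) (vol G W) / max (vol G U) (vol G W)"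
    have "0 \<le> r" "r \<le> balance G"
      using bip balance_ge[OF UW] by (auto simp: r_def)
    then have "2 * r / (1 + r) \<le> 2 * balance G / (1 + balance G)"
      by (rule balance_transform_mono)
    then have "D / vol G (pverts G) \<le> \<bar>vol G U - vol G W\<bar> / vol G (pverts G)"
      using balance_transform(2)[OF bip(5,6) r_def] tr bip(7) by simp
    then show ?thesis
      using v by (simp add: divide_le_cancel W_def)
  qed
  moreover have "\<exists>U\<subseteq>pverts G. D = \<bar>vol G U - vol G (pverts G - U)\<bar>"
    using bip0 by (auto simp: D_def)
  ultimately show ?thesis
    by (intro that[OF _ tr]) (simp_all add: D_def)
qed

lemma regular_vol:
  assumes "regular_graph G" "i \<in> pverts G" "U \<subseteq> pverts G"
  shows "vol G U = card U * degree G i"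
proof -
  have "degree G k = degree G i" if "k \<in> U" for k
    using assms that unfolding regular_graph_def by blast
  then have "vol G U = (\<Sum>_\<in>U. degree G i)"
    unfolding vol_def by (intro sum.cong refl)
  then show ?thesis
    by simp
qed

text \<open>The integer factor has the parity of the number of vertices, so it can vanish only if
  that number is even.\<close>

lemma regular_imbalance:
  assumes "regular_graph G" "i \<in> pverts G" "U \<subseteq> pverts G"
  shows "\<bar>vol G U - vol G (pverts G - U)\<bar>
    = \<bar>2 * int (card U) - int (card (pverts G))\<bar> * degree G i"
proof -
  have "card (pverts G) = card U + card (pverts G - U)"
    using assms(3) pair_finite_verts
    by (metis card_Diff_subset card_mono finite_subset le_add_diff_inverse)
  then have "vol G U - vol G (pverts G - U)
      = (2 * int (card U) - int (card (pverts G))) * degree G i"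
    using regular_vol[OF assms(1,2), of U] regular_vol[OF assms(1,2), of "pverts G - U"] assms(3)
    by (simp add: algebra_simps)
  then show ?thesis
    using degree_ge_1[OF assms(2)] by (simp add: abs_mult)
qed

lemma imbalance_bound:
  fixes D :: real
  assumes D: "0 \<le> D"
    and imb: "\<forall>U\<subseteq>pverts G. D \<le> \<bar>vol G U - vol G (pverts G - U)\<bar>"
    and att: "\<exists>U\<subseteq>pverts G. D = \<bar>vol G U - vol G (pverts G - U)\<bar>"
  shows "card (pverts G) * D \<le> vol G (pverts G)"
    and "card (pverts G) * D = vol G (pverts G) \<longleftrightarrow> regular_graph G \<and> odd (card (pverts G))"
proof -
  have ne: "pverts G \<noteq> {}"
    using card_ge_2 by auto
  have deg_imb: "D \<le> \<bar>sum (degree G) U - sum (degree G) (pverts G - U)\<bar>" if "U \<subseteq> pverts G" for U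
    using imb that by (simp add: vol_def)
  note bound = card_times_imbalance_le[where f = "degree G" and X = "pverts G" and D = D,
      OF pair_finite_verts ne D degree_ge_1 degree_le_card deg_imb, folded vol_def]
  show "card (pverts G) * D \<le> vol G (pverts G)"
    by (rule bound(1))
  obtain i where i: "i \<in> pverts G"
    using ne by blast
  show "card (pverts G) * D = vol G (pverts G) \<longleftrightarrow> regular_graph G \<and> odd (card (pverts G))"
  proof
    assume eq: "card (pverts G) * D = vol G (pverts G)"
    then have deg: "\<And>k. k \<in> pverts G \<Longrightarrow> degree G k = D"
      by (intro bound(2))
    then have reg: "regular_graph G"
      by (simp add: regular_graph_def)
    \<comment> \<open>An even number of vertices could be halved; the halves would have equal
      volume, forcing \<open>D = 0\<close> although \<open>D\<close> is a degree.\<close>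
    have "odd (card (pverts G))"
    proof
      assume "even (card (pverts G))"
      then obtain m where m: "card (pverts G) = 2 * m" ..
      then obtain U where U: "U \<subseteq> pverts G" "card U = m"
        by (metis obtain_subset_with_card_n le_add2 mult_2)
      have "D \<le> 0"
        using imb[rule_format, OF U(1)] regular_imbalance[OF reg i U(1)] m U(2) by simp
      then show False
        using deg[OF i] degree_ge_1[OF i] by linarith
    qed
    with reg show "regular_graph G \<and> odd (card (pverts G))" ..
  next
    assume reg: "regular_graph G \<and> odd (card (pverts G))"
    obtain U where U: "U \<subseteq> pverts G" "D = \<bar>vol G U - vol G (pverts G - U)\<bar>"
      using att by blast
    \<comment> \<open>For odd order the smallest imbalance is at least one degree, which reverses
      the general bound.\<close>
    have "2 * card U \<noteq> card (pverts G)"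
      using reg by (metis dvd_triv_left)
    then have "1 \<le> real_of_int \<bar>2 * int (card U) - int (card (pverts G))\<bar>"
      by linarith
    then have "1 * degree G i \<le> D"
      unfolding U(2) regular_imbalance[OF conjunct1[OF reg] i U(1)]
      using degree_ge_1[OF i] by (intro mult_right_mono) auto
    then have "vol G (pverts G) \<le> card (pverts G) * D"
      using regular_vol[OF conjunct1[OF reg] i order_refl] by (simp add: mult_left_mono)
    then show "card (pverts G) * D = vol G (pverts G)"
      using bound(1) by linarith
  qed
qed

end

theorem theorem4p1:
  fixes G :: "'a pair_pre_digraph" and N :: nat
  assumes "pair_pseudo_graph G"
    and "Digraph_Component.connected (with_proj G)"
    and "N = card (pverts G)" and "N \<ge> 2"
  shows "(real N - 1) / real N * cheeger G \<le> 2 * balance G / (1 + balance G) * cheeger G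
    \<and> 2 * balance G / (1 + balance G) * cheeger G \<le> dual_cheeger G
    \<and> dual_cheeger G \<le> 1
    \<and> ((real N - 1) / real N * cheeger G = 2 * balance G / (1 + balance G) * cheeger G
        \<longleftrightarrow> regular_graph G \<and> odd N)"
proof -
  interpret connected_pseudo_graph G
    using assms by (simp add: connected_pseudo_graph_def connected_pseudo_graph_axioms_def)
  obtain D where D: "0 \<le> D" "2 * balance G / (1 + balance G) = 1 - D / vol G (pverts G)"
    "\<forall>U\<subseteq>pverts G. D \<le> \<bar>vol G U - vol G (pverts G - U)\<bar>"
    "\<exists>U\<subseteq>pverts G. D = \<bar>vol G U - vol G (pverts G - U)\<bar>"
    by (rule minimal_imbalance)
  note bound = imbalance_bound[OF D(1,3,4), folded assms(3)]
  have "0 < vol G (pverts G)"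
    using card_ge_2 by (intro vol_pos) auto
  \<comment> \<open>Since \<open>(N - 1) / N = 1 - 1 / N\<close>, comparing with
    \<open>1 - D / vol G (pverts G)\<close> amounts to comparing \<open>N * D\<close> with the
    volume.\<close>
  then have "(real N - 1) / N \<le> 2 * balance G / (1 + balance G)"
    and "(real N - 1) / N = 2 * balance G / (1 + balance G) \<longleftrightarrow> regular_graph G \<and> odd N"
    using bound assms(4) unfolding D(2) by (auto simp: field_simps)
  then show ?thesis
    using cheeger_pos balance_cheeger_le_dual_cheeger dual_cheeger_le_1
    by (simp add: mult_right_mono del: times_divide_eq_left)
qed

end
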